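(* Let $X$ be a topological space satisfying ${\sf S}_1(\Omega_X,\Omega_X)$ and let $A\in\Omega_X$ be countable with a fixed bijective enumeration. For a subset $N$ of $[A]^{\aleph_0}\cap\Omega_X$, with the Ellentuck topology, the following are equivalent: (1) $N$ is nowhere dense; (2) $N$ is meager.
   Context: An $\omega$-cover of $X$ is an open cover $\mathcal{U}$ with $X\notin\mathcal{U}$ such that each finite subset of $X$ lies in some member of $\mathcal{U}$; $\Omega_X$ is the set of $\omega$-covers. ${\sf S}_1(\Omega_X,\Omega_X)$: for every sequence of $\omega$-covers $(\mathcal{U}_n)$ there are $U_n\in\mathcal{U}_n$ with $\{U_n:n\in\mathbb{N}\}$ an $\omega$-cover. $[S]^{\aleph_0}$ denotes the countably infinite subsets of $S$. With the enumeration $A=\{a_n:n\in\mathbb{N}\}$: for $s,T\subseteq A$, $s<T$ means $a_n\in s$, $a_m\in T$ imply $n<m$; for finite $s$ and infinite $C$ with $s<C$, $[s,C]=\{s\cup D: D\in[A]^{\aleph_0},D\subseteq C\}$. The sets $[s,C]$ form a base of the Ellentuck topology on $[A]^{\aleph_0}$, and $[A]^{\aleph_0}\cap\Omega_X$ carries the subspace topology. Meager means a countable union of nowhere dense sets. *)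

theory Defs
  imports "HOL-Analysis.Analysis"
begin

definition omega_covers :: "'a topology \<Rightarrow> 'a set set set" where
  "omega_covers X =
     {\<U>. (\<forall>U\<in>\<U>. openin X U) \<and> \<Union>\<U> = topspace X \<and> topspace X \<notin> \<U> \<and>
          (\<forall>F. finite F \<and> F \<subseteq> topspace X \<longrightarrow> (\<exists>U\<in>\<U>. F \<subseteq> U))}"

definition S1 :: "'b set set \<Rightarrow> 'b set set \<Rightarrow> bool" where
  "S1 \<A> \<B> \<longleftrightarrow>
     (\<forall>\<U> :: nat \<Rightarrow> 'b set. (\<forall>n. \<U> n \<in> \<A>) \<longrightarrow>
        (\<exists>U. (\<forall>n. U n \<in> \<U> n) \<and> {U n | n. True} \<in> \<B>))"

definition countably_infinite_subsets :: "'b set \<Rightarrow> 'b set set" where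
  "countably_infinite_subsets S = {D. D \<subseteq> S \<and> countable D \<and> infinite D}"

text \<open>In the following, \<open>a\<close> is the enumeration of \<open>A\<close>.\<close>

definition enum_less :: "(nat \<Rightarrow> 'b) \<Rightarrow> 'b set \<Rightarrow> 'b set \<Rightarrow> bool" where
  "enum_less a s T \<longleftrightarrow> (\<forall>n m. a n \<in> s \<longrightarrow> a m \<in> T \<longrightarrow> n < m)"

definition ellentuck_set :: "'b set \<Rightarrow> 'b set \<Rightarrow> 'b set \<Rightarrow> 'b set set" where
  "ellentuck_set A s C = {s \<union> D | D. D \<in> countably_infinite_subsets A \<and> D \<subseteq> C}"

definition ellentuck_base :: "'b set \<Rightarrow> (nat \<Rightarrow> 'b) \<Rightarrow> 'b set set set" where
  "ellentuck_base A a =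
     {ellentuck_set A s C | s C.
        s \<subseteq> A \<and> finite s \<and> C \<subseteq> A \<and> infinite C \<and> enum_less a s C}"

definition ellentuck_topology :: "'b set \<Rightarrow> (nat \<Rightarrow> 'b) \<Rightarrow> 'b set topology" where
  "ellentuck_topology A a = topology_generated_by (ellentuck_base A a)"

definition nowhere_dense_in :: "'b topology \<Rightarrow> 'b set \<Rightarrow> bool" where
  "nowhere_dense_in T S \<longleftrightarrow> S \<subseteq> topspace T \<and> T interior_of (T closure_of S) = {}"

definition meager_in :: "'b topology \<Rightarrow> 'b set \<Rightarrow> bool" where
  "meager_in T S \<longleftrightarrow>
     (\<exists>\<F>. countable \<F> \<and> (\<forall>F\<in>\<F>. nowhere_dense_in T F) \<and> S = \<Union>\<F>)"

text \<open>The generating family really is a base (not merely a subbase) of a topology on the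
  countably infinite subsets of \<open>A\<close>.\<close>

lemma topspace_ellentuck_topology:
  assumes "countable A"
  shows "topspace (ellentuck_topology A a) = countably_infinite_subsets A"
proof
  have "E \<in> countably_infinite_subsets A"
    if "s \<subseteq> A" "finite s" "E \<in> ellentuck_set A s C" for E s C
    using that by (auto simp: ellentuck_set_def countably_infinite_subsets_def countable_finite)
  then show "topspace (ellentuck_topology A a) \<subseteq> countably_infinite_subsets A"
    by (auto simp: ellentuck_topology_def ellentuck_base_def)
  show "countably_infinite_subsets A \<subseteq> topspace (ellentuck_topology A a)"
  proof
    fix E assume E: "E \<in> countably_infinite_subsets A"
    then have "ellentuck_set A {} A \<in> ellentuck_base A a"
      unfolding ellentuck_base_def countably_infinite_subsets_def enum_less_def
      using infinite_super by blast
    moreover have "E \<in> ellentuck_set A {} A"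
      using E by (auto simp: ellentuck_set_def countably_infinite_subsets_def)
    ultimately show "E \<in> topspace (ellentuck_topology A a)"
      by (auto simp: ellentuck_topology_def)
  qed
qed

lemma ellentuck_base_Int:
  assumes "B1 \<in> ellentuck_base A a" "B2 \<in> ellentuck_base A a" "E \<in> B1 \<inter> B2"
  shows "\<exists>B\<in>ellentuck_base A a. E \<in> B \<and> B \<subseteq> B1 \<inter> B2"
proof -
  obtain s C where s: "B1 = ellentuck_set A s C" "s \<subseteq> A" "finite s" "C \<subseteq> A" "enum_less a s C"
    using assms(1) by (auto simp: ellentuck_base_def)
  obtain t D where t: "B2 = ellentuck_set A t D" "t \<subseteq> A" "finite t" "D \<subseteq> A" "enum_less a t D"
    using assms(2) by (auto simp: ellentuck_base_def)
  obtain C' where C': "E = s \<union> C'" "C' \<subseteq> C" "countable C'" "infinite C'"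
    using assms(3) s(1) by (auto simp: ellentuck_set_def countably_infinite_subsets_def)
  obtain D' where D': "E = t \<union> D'" "D' \<subseteq> D"
    using assms(3) t(1) by (auto simp: ellentuck_set_def)
  define u where "u = s \<union> t"
  have u: "u \<subseteq> A" "finite u" "u \<subseteq> E" "E - u \<subseteq> A" "E = u \<union> (E - u)"
    using s t C' D' by (auto simp: u_def)
  have inf: "infinite (E - u)" "countable (E - u)"
    using C' u s(3) by (auto simp: countable_finite)
  have "enum_less a u (E - u)"
    using s(5) t(5) C'(1,2) D' unfolding enum_less_def u_def by blast
  then have "ellentuck_set A u (E - u) \<in> ellentuck_base A a"
    unfolding ellentuck_base_def using u inf by blast
  moreover have "E \<in> ellentuck_set A u (E - u)"
    unfolding ellentuck_set_def countably_infinite_subsets_def using u inf by blast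
  moreover have "F \<in> B1 \<inter> B2" if "F \<in> ellentuck_set A u (E - u)" for F
  proof -
    obtain G where G: "F = u \<union> G" "G \<subseteq> A" "countable G" "infinite G" "G \<subseteq> E - u"
      using \<open>F \<in> _\<close> by (auto simp: ellentuck_set_def countably_infinite_subsets_def)
    have "F = s \<union> ((t - s) \<union> G)" "(t - s) \<union> G \<subseteq> C" "F = t \<union> ((s - t) \<union> G)" "(s - t) \<union> G \<subseteq> D"
      using G C' D' by (auto simp: u_def)
    moreover have "(t - s) \<union> G \<in> countably_infinite_subsets A"
        "(s - t) \<union> G \<in> countably_infinite_subsets A"
      using G s t by (auto simp: countably_infinite_subsets_def countable_finite)
    ultimately show ?thesis
      unfolding s(1) t(1) ellentuck_set_def by blast
  qed
  ultimately show ?thesis by blast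
qed

lemma openin_ellentuck_topology:
  "openin (ellentuck_topology A a) S \<longleftrightarrow> (\<forall>E\<in>S. \<exists>B\<in>ellentuck_base A a. E \<in> B \<and> B \<subseteq> S)"
proof
  assume "openin (ellentuck_topology A a) S"
  then have "generate_topology_on (ellentuck_base A a) S"
    by (simp add: ellentuck_topology_def openin_topology_generated_by_iff)
  then show "\<forall>E\<in>S. \<exists>B\<in>ellentuck_base A a. E \<in> B \<and> B \<subseteq> S"
  proof induction
    case (Int S T)
    show ?case
    proof
      fix E assume "E \<in> S \<inter> T"
      then obtain B1 B2 where B: "B1 \<in> ellentuck_base A a" "E \<in> B1" "B1 \<subseteq> S"
          "B2 \<in> ellentuck_base A a" "E \<in> B2" "B2 \<subseteq> T"
        using Int.IH by blast
      then obtain B where "B \<in> ellentuck_base A a" "E \<in> B" "B \<subseteq> B1 \<inter> B2"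
        using ellentuck_base_Int[of B1 A a B2 E] by blast
      then show "\<exists>B\<in>ellentuck_base A a. E \<in> B \<and> B \<subseteq> S \<inter> T"
        using B by blast
    qed
  next
    case (UN K)
    show ?case
    proof
      fix E assume "E \<in> \<Union>K"
      then obtain k where k: "k \<in> K" "E \<in> k" by blast
      then obtain B where "B \<in> ellentuck_base A a" "E \<in> B" "B \<subseteq> k"
        using UN.IH by blast
      with k show "\<exists>B\<in>ellentuck_base A a. E \<in> B \<and> B \<subseteq> \<Union>K" by blast
    qed
  qed blast+
next
  assume "\<forall>E\<in>S. \<exists>B\<in>ellentuck_base A a. E \<in> B \<and> B \<subseteq> S"
  then have "\<forall>E\<in>S. \<exists>B. openin (ellentuck_topology A a) B \<and> E \<in> B \<and> B \<subseteq> S"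
    unfolding ellentuck_topology_def by (meson topology_generated_by_Basis)
  then show "openin (ellentuck_topology A a) S"
    by (subst openin_subopen)
qed

end

theory Submission
  imports Defs
begin

text \<open>Through the enumeration, the \<open>\<omega>\<close>-covers contained in \<open>A\<close> form a family \<open>H\<close> of sets of
  natural numbers. It is a coideal, and \<open>S\<^sub>1(\<Omega>, \<Omega>)\<close> makes it selective: decreasing sequences in \<open>H\<close>
  have diagonalizations in \<open>H\<close>. Selectivity is exactly what the Nash-Williams accept/reject
  argument needs, so every dense open set contains, below every basic set with stem \<open>s\<close>, a basic
  set with the same stem \<open>s\<close>. Because the stem does not move, one more diagonalization does this for
  countably many dense open sets simultaneously.\<close>

section \<open>Selective coideals\<close>

text \<open>For \<open>s = {}\<close> the condition is vacuous and all of \<open>M\<close> remains,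
  a case in which \<open>Max s\<close> would be meaningless.\<close>

definition above :: "nat set \<Rightarrow> nat set \<Rightarrow> nat set" where
  "above s M = {k \<in> M. \<forall>i\<in>s. i < k}"

lemma above_subset: "above s M \<subseteq> M"
  by (auto simp: above_def)

lemma finite_diff_above:
  assumes "finite s"
  shows "finite (M - above s M)"
proof -
  have "M - above s M \<subseteq> (\<Union>i\<in>s. {..i})"
    by (auto simp: above_def not_less)
  then show ?thesis
    using assms by (meson finite_UN_I finite_atMost finite_subset)
qed

text \<open>The sets outside \<open>H\<close> form an ideal that contains the finite sets. In
  \<open>selective\<close> the index is \<open>Suc m\<close> because, in the fusion below, stage
  \<open>Suc m\<close> is the first at which every finite set with maximum \<open>m\<close> has been
  treated; \<open>C 0\<close> serves the empty set.\<close>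

locale selective_coideal =
  fixes H :: "nat set set"
  assumes superset: "M \<in> H \<Longrightarrow> M \<subseteq> M' \<Longrightarrow> M' \<in> H"
    and union: "M \<union> M' \<in> H \<Longrightarrow> M \<in> H \<or> M' \<in> H"
    and infinite_mem: "M \<in> H \<Longrightarrow> infinite M"
    and selective: "(\<And>n. C n \<in> H) \<Longrightarrow> (\<And>n. C (Suc n) \<subseteq> C n) \<Longrightarrow>
      \<exists>D\<in>H. D \<subseteq> C 0 \<and> (\<forall>m\<in>D. \<forall>k\<in>D. m < k \<longrightarrow> k \<in> C (Suc m))"
begin

text \<open>This is the trace on \<open>H\<close> of an Ellentuck neighbourhood. Cutting
  \<open>M\<close> down to \<open>above s M\<close> builds the side condition of such neighbourhoods
  into the set, so that \<open>s\<close> and \<open>M\<close> can vary independently.\<close>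

definition basic :: "nat set \<Rightarrow> nat set \<Rightarrow> nat set set" where
  "basic s M = {x \<in> H. s \<subseteq> x \<and> x - s \<subseteq> above s M}"

text \<open>Density is tested on \<open>M \<in> H\<close> because, for finite \<open>s\<close>,
  these are exactly the \<open>M\<close> with \<open>basic s M\<close> nonempty.\<close>

definition dense_open :: "nat set set \<Rightarrow> bool" where
  "dense_open V \<longleftrightarrow>
     (\<forall>x\<in>V. \<exists>s M. finite s \<and> x \<in> basic s M \<and> basic s M \<subseteq> V) \<and>
     (\<forall>s M. finite s \<longrightarrow> M \<in> H \<longrightarrow> basic s M \<inter> V \<noteq> {})"

section \<open>Finite changes and tails\<close>

lemma diff_finite_mem:
  assumes "M \<in> H" "finite (M - M')"
  shows "M' \<in> H"
proof -
  \<comment> \<open>Of the two pieces, the first is finite and so cannot be the one in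
    \<open>H\<close>.\<close>
  have "(M - M') \<union> (M \<inter> M') \<in> H"
    using assms(1) by (metis Int_Diff_Un Un_commute)
  then have "M \<inter> M' \<in> H"
    using union[of "M - M'" "M \<inter> M'"] infinite_mem[of "M - M'"] assms(2) by argo
  then show ?thesis
    by (rule superset) simp
qed

lemma above_mem: "M \<in> H \<Longrightarrow> finite s \<Longrightarrow> above s M \<in> H"
  using diff_finite_mem finite_diff_above by blast

lemma union_above_mem_basic:
  assumes "M \<in> H" "finite s"
  shows "s \<union> above s M \<in> basic s M"
  using superset[OF above_mem[OF assms], of "s \<union> above s M"] by (auto simp: basic_def)

lemma basic_mono: "M \<subseteq> M' \<Longrightarrow> basic s M \<subseteq> basic s M'"
  by (auto simp: basic_def above_def)

lemma basic_above: "basic s (above s M) = basic s M"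
  by (auto simp: basic_def above_def)

section \<open>Fusion of hereditary properties\<close>

lemma fusion_finite:
  assumes "finite S" "M \<in> H"
    and hered: "\<And>s D D'. P s D \<Longrightarrow> D' \<in> H \<Longrightarrow> D' \<subseteq> D \<Longrightarrow> P s D'"
    and dense: "\<And>s D. s \<in> S \<Longrightarrow> D \<in> H \<Longrightarrow> D \<subseteq> M \<Longrightarrow> \<exists>D'\<in>H. D' \<subseteq> D \<and> P s D'"
  shows "\<exists>D\<in>H. D \<subseteq> M \<and> (\<forall>s\<in>S. P s D)"
  using assms(1) dense
proof (induction S)
  case empty
  then show ?case using \<open>M \<in> H\<close> by blast
next
  case (insert s S)
  then obtain D where D: "D \<in> H" "D \<subseteq> M" "\<forall>s\<in>S. P s D"
    by (metis insertCI)
  then obtain D' where "D' \<in> H" "D' \<subseteq> D" "P s D'"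
    using insert.prems by blast
  moreover have "P r D'" if "r \<in> S" for r
    using hered[of r D D'] D(3) that calculation by simp
  ultimately show ?case using D(2) by (intro bexI[of _ D']) auto
qed

text \<open>Stage \<open>n\<close> treats the finitely many subsets of \<open>{..<n}\<close>, which
  gives a decreasing sequence in \<open>H\<close>. A diagonalization \<open>D\<close> works: beyond
  \<open>Max s\<close> it lies in \<open>C (Suc (Max s))\<close>, where \<open>s\<close> has been
  treated, and \<open>tail\<close> passes from that part of \<open>D\<close> to
  \<open>D\<close>.\<close>

lemma fusion:
  assumes "M \<in> H"
    and hered: "\<And>s D D'. P s D \<Longrightarrow> D' \<in> H \<Longrightarrow> D' \<subseteq> D \<Longrightarrow> P s D'"
    and tail: "\<And>s D. finite s \<Longrightarrow> P s (above s D) \<Longrightarrow> P s D"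
    and dense: "\<And>s D. finite s \<Longrightarrow> D \<in> H \<Longrightarrow> D \<subseteq> M \<Longrightarrow> \<exists>D'\<in>H. D' \<subseteq> D \<and> P s D'"
  shows "\<exists>D\<in>H. D \<subseteq> M \<and> (\<forall>s. finite s \<longrightarrow> s \<subseteq> D \<longrightarrow> P s D)"
proof -
  have step: "\<exists>D\<in>H. D \<subseteq> M' \<and> (\<forall>s\<in>Pow {..<n}. P s D)" if "M' \<in> H" "M' \<subseteq> M" for M' n
  proof (rule fusion_finite)
    show "\<exists>D'\<in>H. D' \<subseteq> D \<and> P s D'" if "s \<in> Pow {..<n}" "D \<in> H" "D \<subseteq> M'" for s D
      using that \<open>M' \<subseteq> M\<close> by (intro dense) (auto intro: finite_subset)
  qed (use that hered in auto)
  have "\<exists>C. \<forall>n. (C n \<in> H \<and> C n \<subseteq> M \<and> (\<forall>s\<in>Pow {..<n}. P s (C n))) \<and> C (Suc n) \<subseteq> C n"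
  proof (rule dependent_nat_choice)
    show "\<exists>D. D \<in> H \<and> D \<subseteq> M \<and> (\<forall>s\<in>Pow {..<0}. P s D)"
      using step[of M 0] \<open>M \<in> H\<close> by blast
  next
    fix C n assume "C \<in> H \<and> C \<subseteq> M \<and> (\<forall>s\<in>Pow {..<n}. P s C)"
    then show "\<exists>D. (D \<in> H \<and> D \<subseteq> M \<and> (\<forall>s\<in>Pow {..<Suc n}. P s D)) \<and> D \<subseteq> C"
      using step[of C "Suc n"] by blast
  qed
  then obtain C where
    "\<forall>n. (C n \<in> H \<and> C n \<subseteq> M \<and> (\<forall>s\<in>Pow {..<n}. P s (C n))) \<and> C (Suc n) \<subseteq> C n" ..
  then have C: "\<And>n. C n \<in> H" "\<And>n. C n \<subseteq> M" "\<And>n s. s \<subseteq> {..<n} \<Longrightarrow> P s (C n)"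
      "\<And>n. C (Suc n) \<subseteq> C n"
    by simp_all
  obtain D where D: "D \<in> H" "D \<subseteq> C 0" "\<forall>m\<in>D. \<forall>k\<in>D. m < k \<longrightarrow> k \<in> C (Suc m)"
    using selective[of C, OF C(1) C(4)] by (elim bexE conjE)
  have "P s D" if s: "finite s" "s \<subseteq> D" for s
  proof (cases "s = {}")
    case True
    then show ?thesis using hered[OF C(3)[of "{}" 0] D(1,2)] by simp
  next
    case False
    then have "Max s \<in> s" using s by simp
    then have "above s D \<subseteq> C (Suc (Max s))"
      using s(2) D(3) by (auto simp: above_def)
    moreover have "P s (C (Suc (Max s)))"
      using s by (intro C(3)) (auto simp: less_Suc_eq_le)
    ultimately have "P s (above s D)"
      using hered[of s "C (Suc (Max s))" "above s D"] above_mem[OF D(1) s(1)] by blast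
    then show ?thesis by (rule tail[OF s(1)])
  qed
  moreover have "D \<subseteq> M" using D(2) C(2) by blast
  ultimately show ?thesis using D(1) by (intro bexI[of _ D]) simp_all
qed

text \<open>In the Nash-Williams argument, \<open>D\<close> accepts a stem if the basic set lies in
  \<open>V\<close>, and rejects it if no smaller member of \<open>H\<close> accepts it. One fusion
  decides all stems, a second makes rejection pass to extensions by one point. If \<open>s\<close>
  were rejected, so would be every finite extension of \<open>s\<close> inside \<open>E\<close>; but
  density and openness of \<open>V\<close> yield one that is not.\<close>

lemma dense_open_contains_basic:
  assumes V: "dense_open V" and s: "finite s" and M: "M \<in> H"
  shows "\<exists>D\<in>H. D \<subseteq> M \<and> basic s D \<subseteq> V"
proof -
  define rejects where
    "rejects t D \<longleftrightarrow> (\<forall>D'\<in>H. D' \<subseteq> D \<longrightarrow> \<not> basic t D' \<subseteq> V)" for t D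
  have rejects_mono: "rejects t D'" if "rejects t D" "D' \<subseteq> D" for t D D'
    using that by (auto simp: rejects_def)
  have rejects_above: "rejects t D" if "rejects t (above t D)" "finite t" for t D
    unfolding rejects_def
  proof (intro ballI impI notI)
    fix D' assume "D' \<in> H" "D' \<subseteq> D" "basic t D' \<subseteq> V"
    moreover have "above t D' \<subseteq> above t D" using \<open>D' \<subseteq> D\<close> by (auto simp: above_def)
    ultimately show False
      using that above_mem[of D' t] basic_above[of t D'] by (metis rejects_def)
  qed
  have "\<exists>D\<in>H. D \<subseteq> above s M \<and> (\<forall>t. finite t \<longrightarrow> t \<subseteq> D \<longrightarrow>
      basic (s \<union> t) D \<subseteq> V \<or> rejects (s \<union> t) D)"
  proof (rule fusion)
    show "above s M \<in> H" using M s by (rule above_mem)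
    show "basic (s \<union> t) D' \<subseteq> V \<or> rejects (s \<union> t) D'"
      if "basic (s \<union> t) D \<subseteq> V \<or> rejects (s \<union> t) D" "D' \<in> H" "D' \<subseteq> D" for t D D'
      using that rejects_mono basic_mono by blast
    show "basic (s \<union> t) D \<subseteq> V \<or> rejects (s \<union> t) D"
      if "finite t" "basic (s \<union> t) (above t D) \<subseteq> V \<or> rejects (s \<union> t) (above t D)" for t D
    proof -
      have "above (s \<union> t) D \<subseteq> above t D" by (auto simp: above_def)
      then show ?thesis
        using that s rejects_mono rejects_above basic_mono basic_above
        by (metis finite_Un order_trans)
    qed
    show "\<exists>D'\<in>H. D' \<subseteq> D \<and> (basic (s \<union> t) D' \<subseteq> V \<or> rejects (s \<union> t) D')"
      if "D \<in> H" for t D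
      \<comment> \<open>Either some smaller \<open>D'\<close> accepts, or \<open>D\<close> itself
        rejects by definition.\<close>
      using that by (auto simp: rejects_def)
  qed
  then obtain D where D: "D \<in> H" "D \<subseteq> above s M"
    and "\<forall>t. finite t \<longrightarrow> t \<subseteq> D \<longrightarrow> basic (s \<union> t) D \<subseteq> V \<or> rejects (s \<union> t) D"
    by (elim bexE conjE)
  then have decided: "\<And>t. finite t \<Longrightarrow> t \<subseteq> D \<Longrightarrow> basic (s \<union> t) D \<subseteq> V \<or> rejects (s \<union> t) D"
    by simp
  have "\<exists>E\<in>H. E \<subseteq> D \<and> (\<forall>t. finite t \<longrightarrow> t \<subseteq> E \<longrightarrow>
      rejects (s \<union> t) D \<longrightarrow> t \<subseteq> D \<longrightarrow> (\<forall>k\<in>above t E. rejects (s \<union> insert k t) D))"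
  proof (rule fusion)
    show "D \<in> H" by fact
    show "\<exists>E'\<in>H. E' \<subseteq> E \<and> (rejects (s \<union> t) D \<longrightarrow> t \<subseteq> D \<longrightarrow>
        (\<forall>k\<in>above t E'. rejects (s \<union> insert k t) D))"
      if E: "E \<in> H" "E \<subseteq> D" and t: "finite t" for t E
    proof (cases "rejects (s \<union> t) D \<and> t \<subseteq> D")
      case True
      \<comment> \<open>\<open>G\<close> consists of the accepted one-point extensions. Sorting the
        members of \<open>basic (s \<union> t) G\<close> by their least new element \<open>k\<close>
        shows that \<open>G\<close> would accept \<open>s \<union> t\<close> if it were in
        \<open>H\<close>. So rejection forces \<open>G \<notin> H\<close>, and the coideal property
        leaves \<open>E - G\<close>.\<close>
      define G where "G = {k \<in> above t E. basic (s \<union> insert k t) D \<subseteq> V}"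
      have "basic (s \<union> t) G \<subseteq> V"
      proof
        fix x assume x: "x \<in> basic (s \<union> t) G"
        then have xH: "x \<in> H" and sub: "s \<union> t \<subseteq> x" "x - (s \<union> t) \<subseteq> above (s \<union> t) G"
          by (auto simp: basic_def)
        define k where "k = (LEAST k. k \<in> x - (s \<union> t))"
        have "x - (s \<union> t) \<noteq> {}"
          using infinite_mem[OF xH] s t by (metis finite_Un finite_subset Diff_eq_empty_iff)
        then have k: "k \<in> x - (s \<union> t)"
          unfolding k_def by (metis LeastI ex_in_conv)
        have least: "k < j" if "j \<in> x - (s \<union> t)" "j \<noteq> k" for j
          using Least_le[of "\<lambda>k. k \<in> x - (s \<union> t)" j] that unfolding k_def by simp
        have "k \<in> G" using k sub above_subset by blast
        moreover have "x \<in> basic (s \<union> insert k t) D"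
          unfolding basic_def
        proof (intro CollectI conjI subsetI)
          fix j assume j: "j \<in> x - (s \<union> insert k t)"
          then have "j \<in> above (s \<union> t) G" "k < j" using sub least by auto
          moreover have "j \<in> D"
            using calculation E by (auto simp: above_def G_def)
          ultimately show "j \<in> above (s \<union> insert k t) D"
            by (auto simp: above_def)
        qed (use xH sub k in auto)
        ultimately show "x \<in> V" unfolding G_def by blast
      qed
      moreover have "G \<subseteq> D" using E above_subset unfolding G_def by blast
      ultimately have "G \<notin> H" using True by (auto simp: rejects_def)
      moreover have "G \<union> (E - G) \<in> H" using superset[OF E(1), of "G \<union> (E - G)"] by simp
      ultimately have "E - G \<in> H" using union[of G "E - G"] by simp
      moreover have "rejects (s \<union> insert k t) D" if "k \<in> above t (E - G)" for k
      proof -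
        have "k \<in> above t E" "k \<notin> G" "k \<in> D" using that E by (auto simp: above_def)
        then show ?thesis using decided[of "insert k t"] t True by (simp add: G_def)
      qed
      ultimately show ?thesis by (intro bexI[of _ "E - G"]) auto
    qed (use E in auto)
  qed (auto simp: above_def)
  then obtain E where E: "E \<in> H" "E \<subseteq> D" and "\<forall>t. finite t \<longrightarrow> t \<subseteq> E \<longrightarrow>
      rejects (s \<union> t) D \<longrightarrow> t \<subseteq> D \<longrightarrow> (\<forall>k\<in>above t E. rejects (s \<union> insert k t) D)"
    by (elim bexE conjE)
  then have extend: "\<And>t k. finite t \<Longrightarrow> t \<subseteq> E \<Longrightarrow> rejects (s \<union> t) D \<Longrightarrow> k \<in> above t E \<Longrightarrow>
      rejects (s \<union> insert k t) D"
    by (meson order_trans)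
  show ?thesis
  proof (cases "basic s D \<subseteq> V")
    case True
    then show ?thesis using D above_subset by blast
  next
    case False
    then have base: "rejects s D" using decided[of "{}"] by simp
    \<comment> \<open>The induction adds elements in increasing order, so each new one lies in
      \<open>above t E\<close> and \<open>extend\<close> applies.\<close>
    have rejects_all: "rejects (s \<union> t) D" if "finite t" "t \<subseteq> E" for t
      using that
    proof (induction t rule: finite_linorder_max_induct)
      case empty
      then show ?case using base by simp
    next
      case (insert k t)
      then show ?case using extend[of t k] by (auto simp: above_def)
    qed
    obtain x where x: "x \<in> basic s E" "x \<in> V"
      using V s E(1) unfolding dense_open_def by (metis disjoint_iff)
    then obtain u G where u: "finite u" "x \<in> basic u G" "basic u G \<subseteq> V"
      using V unfolding dense_open_def by metis
    \<comment> \<open>The initial segment of \<open>x\<close> up to \<open>m\<close> contains both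
      stems; the \<open>0\<close> covers the case that both are empty. Members of
      \<open>basic v (x - s)\<close> are then subsets of \<open>x\<close> containing
      \<open>u\<close>, hence lie in \<open>basic u G\<close>, and \<open>x - s\<close> refutes the
      rejection of \<open>v\<close>.\<close>
    define m where "m = Max (insert 0 (u \<union> s))"
    have m: "i \<le> m" if "i \<in> u \<union> s" for i
      unfolding m_def using that u s by (intro Max_ge) auto
    define v where "v = x \<inter> {..m}"
    have xE: "s \<subseteq> x" "x - s \<subseteq> E" "x \<in> H" using x by (auto simp: basic_def above_def)
    have v: "s \<subseteq> v" "u \<subseteq> v" using m xE u(2) by (auto simp: v_def basic_def)
    have "basic v (x - s) \<subseteq> basic u G"
    proof
      fix y assume y: "y \<in> basic v (x - s)"
      then have "y \<subseteq> x" unfolding basic_def v_def above_def by blast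
      with y u(2) v show "y \<in> basic u G" unfolding basic_def by blast
    qed
    moreover have "x - s \<in> H"
      using diff_finite_mem[of x "x - s"] xE s by (simp add: Diff_Diff_Int)
    ultimately have "\<not> rejects v D"
      using u(3) xE(2) E(2) unfolding rejects_def by blast
    moreover have "rejects (s \<union> (v - s)) D"
      using xE by (intro rejects_all) (auto simp: v_def)
    ultimately show ?thesis using v by (simp add: Un_absorb1)
  qed
qed

text \<open>For each stem extension \<open>t\<close> the fusion treats only the finitely many
  \<open>V n\<close> with \<open>n \<le> card t\<close>. This suffices: given \<open>x\<close> and
  \<open>n\<close>, moving the first \<open>n\<close> elements of \<open>x - s\<close> into the stem
  gives a \<open>t\<close> of cardinality exactly \<open>n\<close>.\<close>

theorem countable_dense_open_contain_basic:
  fixes V :: "nat \<Rightarrow> nat set set"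
  assumes V: "\<And>n. dense_open (V n)" and s: "finite s" and M: "M \<in> H"
  shows "\<exists>D\<in>H. D \<subseteq> M \<and> basic s D \<subseteq> (\<Inter>n. V n)"
proof -
  have "\<exists>D\<in>H. D \<subseteq> above s M \<and> (\<forall>t. finite t \<longrightarrow> t \<subseteq> D \<longrightarrow>
      (\<forall>n\<in>{..card t}. basic (s \<union> t) D \<subseteq> V n))"
  proof (rule fusion)
    show "above s M \<in> H" using M s by (rule above_mem)
    show "\<forall>n\<in>{..card t}. basic (s \<union> t) D \<subseteq> V n"
      if "finite t" "\<forall>n\<in>{..card t}. basic (s \<union> t) (above t D) \<subseteq> V n" for t D
    proof -
      have "above (s \<union> t) D \<subseteq> above t D" by (auto simp: above_def)
      then show ?thesis
        using that basic_mono basic_above by (metis order_trans)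
    qed
    show "\<exists>D'\<in>H. D' \<subseteq> D \<and> (\<forall>n\<in>{..card t}. basic (s \<union> t) D' \<subseteq> V n)"
      if "finite t" "D \<in> H" for t D
    proof (rule fusion_finite)
      show "\<exists>D''\<in>H. D'' \<subseteq> D' \<and> basic (s \<union> t) D'' \<subseteq> V n" if "D' \<in> H" for n D'
        using dense_open_contains_basic[OF V _ that] s \<open>finite t\<close> by blast
    qed (use that basic_mono in blast)+
  qed (use basic_mono in blast)
  then obtain D where D: "D \<in> H" "D \<subseteq> above s M"
    and "\<forall>t. finite t \<longrightarrow> t \<subseteq> D \<longrightarrow> (\<forall>n\<in>{..card t}. basic (s \<union> t) D \<subseteq> V n)"
    by (elim bexE conjE)
  then have sub: "\<And>t n. finite t \<Longrightarrow> t \<subseteq> D \<Longrightarrow> n \<le> card t \<Longrightarrow> basic (s \<union> t) D \<subseteq> V n"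
    by simp
  have "x \<in> V n" if x: "x \<in> basic s D" for x n
  proof -
    have xD: "x \<in> H" "s \<subseteq> x" "x - s \<subseteq> above s D" using x by (auto simp: basic_def)
    then have inf: "infinite (x - s)" using infinite_mem s by (metis finite_Diff2)
    define t where "t = enumerate (x - s) ` {..<n}"
    have t: "finite t" "card t = n" "t \<subseteq> x - s"
      using inf enumerate_in_set[OF inf] strict_mono_enumerate[OF inf]
      by (auto simp: t_def card_image strict_mono_imp_inj_on inj_on_subset)
    have "x \<in> basic (s \<union> t) D"
      unfolding basic_def
    proof (intro CollectI conjI subsetI)
      fix k assume k: "k \<in> x - (s \<union> t)"
      then obtain j where j: "k = enumerate (x - s) j" using inf enumerate_Ex[of "x - s" k] by auto
      with k have "n \<le> j" by (auto simp: t_def not_less[symmetric])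
      then have "i < k" if "i \<in> t" for i
        using that j enumerate_mono[OF _ inf] by (auto simp: t_def)
      then show "k \<in> above (s \<union> t) D" using k xD by (auto simp: above_def)
    qed (use xD t in auto)
    moreover have "t \<subseteq> D" using t xD above_subset by blast
    ultimately show ?thesis using sub[of t n] t by auto
  qed
  then have "basic s D \<subseteq> (\<Inter>n. V n)" by blast
  moreover have "D \<subseteq> M" using D(2) above_subset[of s M] by simp
  ultimately show ?thesis using D(1) by blast
qed

end

section \<open>Selectivity of \<open>\<omega>\<close>-covers\<close>

locale enumerated_omega_cover =
  fixes X :: "'a topology" and A :: "'a set set" and a :: "nat \<Rightarrow> 'a set"
  assumes S1: "S1 (omega_covers X) (omega_covers X)"
    and cover: "A \<in> omega_covers X"
    and bij: "bij_betw a UNIV A"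
begin

text \<open>Passing to indices turns the order behind \<open>enum_less\<close> into the usual order
  of the natural numbers.\<close>

definition H :: "nat set set" where
  "H = {M. a ` M \<in> omega_covers X}"

section \<open>The coideal of index sets\<close>

lemma range_a: "range a = A" and inj_a: "inj a"
  using bij by (auto simp: bij_betw_def)

lemma a_mem: "a k \<in> A"
  using range_a by blast

lemma openin_a: "openin X (a k)"
  using cover a_mem[of k] by (simp add: omega_covers_def)

lemma a_ne_topspace: "a k \<noteq> topspace X"
  using cover a_mem[of k] by (auto simp: omega_covers_def)

lemma omega_coversI:
  assumes "\<And>U. U \<in> \<U> \<Longrightarrow> openin X U" "topspace X \<notin> \<U>"
    and "\<And>F. finite F \<Longrightarrow> F \<subseteq> topspace X \<Longrightarrow> \<exists>U\<in>\<U>. F \<subseteq> U"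
  shows "\<U> \<in> omega_covers X"
proof -
  have "x \<in> \<Union>\<U>" if "x \<in> topspace X" for x
    using assms(3)[of "{x}"] that by auto
  moreover have "\<Union>\<U> \<subseteq> topspace X" using assms(1) openin_subset by blast
  ultimately have "\<Union>\<U> = topspace X" by blast
  then show ?thesis using assms by (simp add: omega_covers_def)
qed

text \<open>Members of \<open>A\<close> are open and differ from the whole space, and singletons
  \<open>F\<close> already give the covering condition.\<close>

lemma H_iff: "M \<in> H \<longleftrightarrow> (\<forall>F. finite F \<longrightarrow> F \<subseteq> topspace X \<longrightarrow> (\<exists>k\<in>M. F \<subseteq> a k))"
proof
  assume "M \<in> H"
  then show "\<forall>F. finite F \<longrightarrow> F \<subseteq> topspace X \<longrightarrow> (\<exists>k\<in>M. F \<subseteq> a k)"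
    by (simp add: H_def omega_covers_def)
next
  assume "\<forall>F. finite F \<longrightarrow> F \<subseteq> topspace X \<longrightarrow> (\<exists>k\<in>M. F \<subseteq> a k)"
  moreover have "topspace X \<notin> a ` M" using a_ne_topspace by (metis imageE)
  ultimately have "a ` M \<in> omega_covers X"
    using openin_a by (intro omega_coversI) auto
  then show "M \<in> H" by (simp add: H_def)
qed

lemma H_superset: "M \<in> H \<Longrightarrow> M \<subseteq> M' \<Longrightarrow> M' \<in> H"
  unfolding H_iff by (meson subsetD)

text \<open>If \<open>F\<close> defeats \<open>M\<close> and \<open>F'\<close> defeats
  \<open>M'\<close>, then \<open>F \<union> F'\<close> defeats the union.\<close>

lemma H_union:
  assumes "M \<union> M' \<in> H"
  shows "M \<in> H \<or> M' \<in> H"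
proof (rule ccontr)
  assume "\<not> ?thesis"
  then obtain F F' where F: "finite F" "F \<subseteq> topspace X" "\<forall>k\<in>M. \<not> F \<subseteq> a k"
      "finite F'" "F' \<subseteq> topspace X" "\<forall>k\<in>M'. \<not> F' \<subseteq> a k"
    unfolding H_iff by blast
  then obtain k where "k \<in> M \<union> M'" "F \<union> F' \<subseteq> a k"
    using assms unfolding H_iff by (metis finite_Un Un_least)
  with F(3,6) show False by auto
qed

text \<open>Choosing a point outside each \<open>a k\<close> with \<open>k \<in> M\<close> would,
  for finite \<open>M\<close>, give a finite set contained in none of them.\<close>

lemma H_infinite:
  assumes "M \<in> H"
  shows "infinite M"
proof
  assume "finite M"
  have "\<exists>p. p \<in> topspace X - a k" for k
    using openin_subset[OF openin_a, of k] a_ne_topspace[of k] by blast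
  then obtain p where p: "\<And>k. p k \<in> topspace X - a k" by metis
  then obtain k where "k \<in> M" "p ` M \<subseteq> a k"
    using assms \<open>finite M\<close> unfolding H_iff by (metis DiffD1 finite_imageI image_subsetI)
  with p show False by blast
qed

text \<open>This is the argument of \<open>diff_finite_mem\<close>, available here before
  selectivity of \<open>H\<close> is proved.\<close>

lemma H_diff_finite:
  assumes "M \<in> H" "finite S"
  shows "M - S \<in> H"
proof -
  have "S \<union> (M - S) \<in> H" using H_superset[OF assms(1), of "S \<union> (M - S)"] by simp
  then show ?thesis using H_union[of S "M - S"] H_infinite[of S] assms(2) by argo
qed

section \<open>Consequences of the selection principle\<close>

lemma ex_omega_cover_selection:
  assumes "\<And>n. \<W> n \<in> omega_covers X"
  shows "\<exists>w. (\<forall>n::nat. w n \<in> \<W> n) \<and> range w \<in> omega_covers X"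
  using S1[unfolded S1_def, rule_format, of \<W>] assms by (simp add: full_SetCompr_eq)

text \<open>Applying \<open>S\<^sub>1\<close> to the covers by intersections of \<open>n + 1\<close> members from distinct blocks leaves,
  in step \<open>n\<close>, one member whose block has not been used before.\<close>

lemma H_one_per_block:
  fixes b :: "nat \<Rightarrow> nat"
  assumes R: "R \<in> H" and b: "\<And>i. finite {k. b k = i}"
  shows "\<exists>E\<in>H. E \<subseteq> R \<and> inj_on b E"
proof -
  define T where "T n = {t. t \<subseteq> R \<and> finite t \<and> card t = Suc n \<and> inj_on b t}" for n
  define W where "W n = (\<lambda>t. \<Inter>k\<in>t. a k) ` T n" for n
  have ex: "\<exists>t. t \<subseteq> R \<and> finite t \<and> card t = n \<and> inj_on b t \<and> (\<forall>k\<in>t. F \<subseteq> a k)"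
    if F: "finite F" "F \<subseteq> topspace X" for F n
  proof (induction n)
    case 0
    show ?case by (rule exI[of _ "{}"]) auto
  next
    case (Suc n)
    then obtain t where t: "t \<subseteq> R" "finite t" "card t = n" "inj_on b t" "\<forall>k\<in>t. F \<subseteq> a k"
      by blast
    \<comment> \<open>The blocks already met contain finitely many indices in all, so deleting them
      from \<open>R\<close> stays in \<open>H\<close>.\<close>
    have "finite (\<Union>i\<in>b ` t. {k. b k = i})" using t b by blast
    then have "R - (\<Union>i\<in>b ` t. {k. b k = i}) \<in> H" by (rule H_diff_finite[OF R])
    then obtain k where "k \<in> R - (\<Union>i\<in>b ` t. {k. b k = i})" "F \<subseteq> a k"
      using F unfolding H_iff by metis
    then have "k \<in> R" "b k \<notin> b ` t" "F \<subseteq> a k" by auto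
    with t show ?case by (intro exI[of _ "insert k t"]) (auto simp: card_insert_if)
  qed
  have covers: "W n \<in> omega_covers X" for n
  proof (rule omega_coversI)
    show "openin X U" if "U \<in> W n" for U
    proof -
      obtain t where t: "t \<in> T n" "U = (\<Inter>k\<in>t. a k)" using \<open>U \<in> W n\<close> by (auto simp: W_def)
      then have "finite t" "t \<noteq> {}" by (auto simp: T_def)
      then show ?thesis unfolding t(2) using openin_a by (intro openin_INT2) auto
    qed
    show "topspace X \<notin> W n"
    proof
      assume "topspace X \<in> W n"
      then obtain t where t: "t \<in> T n" "topspace X = (\<Inter>k\<in>t. a k)" by (auto simp: W_def)
      then obtain k where "k \<in> t" by (fastforce simp: T_def)
      then show False
        using t a_ne_topspace[of k] openin_subset[OF openin_a, of k] by blast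
    qed
    show "\<exists>U\<in>W n. F \<subseteq> U" if F: "finite F" "F \<subseteq> topspace X" for F
    proof -
      obtain t where "t \<in> T n" "\<forall>k\<in>t. F \<subseteq> a k"
        using ex[OF F, of "Suc n"] by (auto simp: T_def)
      then show ?thesis unfolding W_def by (intro bexI[of _ "\<Inter>k\<in>t. a k"]) auto
    qed
  qed
  obtain w where w: "\<forall>n. w n \<in> W n" "range w \<in> omega_covers X"
    using ex_omega_cover_selection[of W, OF covers] by (elim exE conjE)
  then have "\<forall>n. \<exists>t. t \<in> T n \<and> w n = (\<Inter>k\<in>t. a k)" by (auto simp: W_def)
  then obtain t where t: "\<And>n. t n \<in> T n" "\<And>n. w n = (\<Inter>k\<in>t n. a k)" by metis
  \<comment> \<open>By pigeonhole, \<open>t n\<close> meets \<open>Suc n\<close> blocks and at most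
    \<open>n\<close> have been used.\<close>
  have "\<exists>e. \<forall>n::nat. e n \<in> t n \<and> b (e n) \<notin> b ` e ` {..<n}"
  proof (rule dependent_wellorder_choice)
    fix r n and f g :: "nat \<Rightarrow> nat" assume "\<And>m. m < n \<Longrightarrow> f m = g m"
    then have "f ` {..<n} = g ` {..<n}" by auto
    then show "(r \<in> t n \<and> b r \<notin> b ` f ` {..<n}) = (r \<in> t n \<and> b r \<notin> b ` g ` {..<n})" by simp
  next
    fix n and f :: "nat \<Rightarrow> nat"
    have "card (b ` f ` {..<n}) \<le> n"
      by (metis card_image_le card_lessThan finite_imageI finite_lessThan order_trans)
    moreover have "card (b ` t n) = Suc n" using t(1)[of n] by (simp add: T_def card_image)
    ultimately have "\<not> b ` t n \<subseteq> b ` f ` {..<n}"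
      using card_mono[of "b ` f ` {..<n}" "b ` t n"] by auto
    then show "\<exists>r. r \<in> t n \<and> b r \<notin> b ` f ` {..<n}" by blast
  qed
  then obtain e where e: "\<And>n. e n \<in> t n" "\<And>n m. m < n \<Longrightarrow> b (e n) \<noteq> b (e m)"
    by (metis imageI lessThan_iff)
  \<comment> \<open>Each \<open>w n\<close> is contained in \<open>a (e n)\<close>, so enlarging the
    selected intersections to single members keeps the \<omega>-cover property.\<close>
  have "range e \<in> H"
    unfolding H_iff
  proof (intro allI impI)
    fix F assume "finite F" "F \<subseteq> topspace X"
    then obtain n where "F \<subseteq> w n" using w(2) by (auto simp: omega_covers_def)
    then show "\<exists>k\<in>range e. F \<subseteq> a k" using t(2) e(1) by blast
  qed
  moreover have "range e \<subseteq> R" using e(1) t(1) by (auto simp: T_def)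
  moreover have "inj_on b (range e)"
    by (rule inj_onI) (metis e(2) imageE linorder_neqE_nat)
  ultimately show ?thesis by blast
qed

text \<open>A selection \<open>u n \<in> C n\<close> given by \<open>S1\<close> works: since
  \<open>C\<close> decreases, only the values \<open>u j\<close> with \<open>j < n\<close> can fall
  outside \<open>C n\<close>.\<close>

lemma H_pseudo_intersection:
  assumes C: "\<And>n. C n \<in> H" "\<And>n. C (Suc n) \<subseteq> C n"
  shows "\<exists>R\<in>H. R \<subseteq> C 0 \<and> (\<forall>n. finite (R - C n))"
proof -
  have covers: "a ` C n \<in> omega_covers X" for n
    using C(1) by (simp add: H_def)
  obtain U where U: "\<forall>n. U n \<in> a ` C n" "range U \<in> omega_covers X"
    using ex_omega_cover_selection[of "\<lambda>n. a ` C n", OF covers] by (elim exE conjE)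
  then have "\<forall>n. \<exists>k. k \<in> C n \<and> U n = a k" by blast
  then obtain u where u: "\<And>n. u n \<in> C n" "\<And>n. U n = a (u n)" by metis
  have anti: "C n \<subseteq> C m" if "m \<le> n" for m n
    using lift_Suc_antimono_le[of C] C(2) that by blast
  have "range U = a ` range u" using u(2) by (simp add: image_image)
  then have "range u \<in> H" using U by (simp add: H_def)
  moreover have "range u \<subseteq> C 0" using u(1) anti[OF le0] by blast
  moreover have "finite (range u - C n)" for n
  proof -
    have "range u - C n \<subseteq> u ` {..<n}"
    proof
      fix k assume "k \<in> range u - C n"
      then obtain j where j: "k = u j" "u j \<notin> C n" by blast
      then have "\<not> n \<le> j" using u(1)[of j] anti[of n j] by blast
      with j show "k \<in> u ` {..<n}" by simp
    qed
    then show ?thesis using finite_subset by blast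
  qed
  ultimately show ?thesis by (intro bexI[of _ "range u"]) auto
qed

text \<open>Cut the natural numbers into blocks ending at \<open>g 0 < g 1 < ...\<close>, with
  \<open>R\<close> beyond \<open>g (Suc n)\<close> contained in \<open>C (Suc (g n))\<close>. Thin
  out a pseudo-intersection \<open>R\<close> to one point per block, then to blocks of one parity.
  Between two remaining points \<open>m < k\<close> lies a whole block, which forces
  \<open>k\<close> into \<open>C (Suc (g (b m)))\<close>, a subset of
  \<open>C (Suc m)\<close>.\<close>

lemma H_selective:
  assumes C: "\<And>n. C n \<in> H" "\<And>n. C (Suc n) \<subseteq> C n"
  shows "\<exists>D\<in>H. D \<subseteq> C 0 \<and> (\<forall>m\<in>D. \<forall>k\<in>D. m < k \<longrightarrow> k \<in> C (Suc m))"
proof -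
  obtain R where R: "R \<in> H" "R \<subseteq> C 0" "\<And>n. finite (R - C n)"
    using H_pseudo_intersection[of C] C by blast
  have anti: "C n \<subseteq> C m" if "m \<le> n" for m n
    using lift_Suc_antimono_le[of C] C(2) that by blast
  have "\<exists>g::nat \<Rightarrow> nat. \<forall>n. True \<and> (g n < g (Suc n) \<and> R - C (Suc (g n)) \<subseteq> {..<g (Suc n)})"
  proof (rule dependent_nat_choice)
    fix x :: nat
    have "finite (insert x (R - C (Suc x)))" using R(3) by simp
    then obtain y where "insert x (R - C (Suc x)) \<subseteq> {..<y}"
      using finite_nat_iff_bounded by blast
    then show "\<exists>y. True \<and> (x < y \<and> R - C (Suc x) \<subseteq> {..<y})" by auto
  qed simp
  then obtain g where g: "\<And>n::nat. g n < g (Suc n)" "\<And>n. R - C (Suc (g n)) \<subseteq> {..<g (Suc n)}"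
    by blast
  have sm: "strict_mono g" using g(1) by (simp add: strict_mono_Suc_iff)
  define b where "b k = (LEAST i. k < g i)" for k
  have ex: "\<exists>i. k < g i" for k
    using strict_mono_imp_increasing[OF sm, of "Suc k"] by (intro exI[of _ "Suc k"]) simp
  have b_gt: "k < g (b k)" for k
    unfolding b_def using ex by (rule LeastI_ex)
  have b_le: "b k \<le> i" if "k < g i" for k i
    unfolding b_def using that by (rule Least_le)
  have b_mono: "b m \<le> b k" if "m \<le> k" for m k
    using b_le b_gt that by (meson le_less_trans)
  have "finite {k. b k = i}" for i
  proof -
    have "{k. b k = i} \<subseteq> {..<g i}" using b_gt by auto
    then show ?thesis using finite_subset by blast
  qed
  then obtain E where E: "E \<in> H" "E \<subseteq> R" "inj_on b E"
    using H_one_per_block[OF R(1), of b] by blast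
  \<comment> \<open>Points in adjacent blocks may be too close; the coideal property keeps one
    parity class in \<open>H\<close>.\<close>
  have "{k\<in>E. even (b k)} \<union> {k\<in>E. odd (b k)} = E" by auto
  then obtain D where D: "D \<in> H" "D \<subseteq> E" "\<And>m k. m \<in> D \<Longrightarrow> k \<in> D \<Longrightarrow> even (b m) = even (b k)"
    using H_union[of "{k\<in>E. even (b k)}" "{k\<in>E. odd (b k)}"] E(1) by auto
  have "k \<in> C (Suc m)" if mk: "m \<in> D" "k \<in> D" "m < k" for m k
  proof -
    have "b m \<noteq> b k" using E(3) D(2) mk by (metis inj_onD less_irrefl subsetD)
    moreover have "even (b m) = even (b k)" using D(3) mk by blast
    ultimately have "Suc (b m) < b k"
      using b_mono[of m k] mk(3) by (metis even_Suc le_neq_implies_less less_imp_le Suc_lessI)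
    then have "g (Suc (b m)) \<le> k" using b_le by (meson not_less)
    moreover have "k \<in> R" using mk(2) D(2) E(2) by blast
    ultimately have "k \<in> C (Suc (g (b m)))" using g(2)[of "b m"] by (auto simp: subset_iff)
    then show ?thesis using anti[of "Suc m" "Suc (g (b m))"] b_gt[of m] by auto
  qed
  moreover have "D \<subseteq> C 0" using D(2) E(2) R(2) by blast
  ultimately show ?thesis using D(1) by (intro bexI[of _ D]) simp_all
qed

sublocale selective_coideal H
  by unfold_locales (fact H_superset H_union H_infinite H_selective)+

section \<open>The Ellentuck topology on \<open>\<omega>\<close>-covers\<close>

definition Y :: "'a set set set" where
  "Y = countably_infinite_subsets A \<inter> omega_covers X"

definition T :: "'a set set topology" where
  "T = subtopology (ellentuck_topology A a) Y"

section \<open>Translation of Ellentuck neighbourhoods\<close>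

lemma countable_A: "countable A"
  using range_a by (metis countableI_type countable_image)

lemma topspace_T: "topspace T = Y"
  by (auto simp: T_def Y_def topspace_ellentuck_topology[OF countable_A])

lemma Y_eq: "Y = (`) a ` H"
proof
  show "Y \<subseteq> (`) a ` H"
  proof
    fix E assume E: "E \<in> Y"
    then have "E = a ` (a -` E)"
      using range_a by (auto simp: Y_def countably_infinite_subsets_def)
    moreover have "a -` E \<in> H" using E calculation by (simp add: H_def Y_def)
    ultimately show "E \<in> (`) a ` H" by blast
  qed
  show "(`) a ` H \<subseteq> Y"
    using H_infinite inj_a range_a
    by (auto simp: Y_def H_def countably_infinite_subsets_def finite_image_iff inj_on_subset)
qed

text \<open>The order condition makes \<open>above s M\<close> equal to \<open>M\<close>. For the
  converse inclusion, the infinite part is the image of \<open>x - s\<close>, which is infinite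
  because \<open>s\<close> is finite.\<close>

lemma ellentuck_set_eq_basic:
  assumes "enum_less a (a ` s) (a ` M)" "finite s"
  shows "ellentuck_set A (a ` s) (a ` M) \<inter> Y = (`) a ` basic s M"
proof -
  have M: "above s M = M"
    using assms(1) by (auto simp: above_def enum_less_def)
  have "a ` x \<in> ellentuck_set A (a ` s) (a ` M) \<longleftrightarrow> x \<in> basic s M" if x: "x \<in> H" for x
  proof
    assume "a ` x \<in> ellentuck_set A (a ` s) (a ` M)"
    then obtain D where "a ` x = a ` s \<union> D" "D \<subseteq> a ` M"
      by (auto simp: ellentuck_set_def)
    then have "a ` s \<subseteq> a ` x" "a ` x \<subseteq> a ` (s \<union> M)" by auto
    then have "s \<subseteq> x" "x \<subseteq> s \<union> M" using inj_a by (simp_all add: inj_image_subset_iff)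
    then show "x \<in> basic s M" using x M by (auto simp: basic_def)
  next
    assume "x \<in> basic s M"
    then have *: "s \<subseteq> x" "x - s \<subseteq> M" using M by (auto simp: basic_def)
    have "infinite (a ` (x - s))"
      using H_infinite[OF x] assms(2) inj_a by (simp add: finite_image_iff inj_on_subset)
    then have "a ` (x - s) \<in> countably_infinite_subsets A"
      using range_a by (auto simp: countably_infinite_subsets_def)
    moreover have "a ` x = a ` s \<union> a ` (x - s)" using * by auto
    ultimately show "a ` x \<in> ellentuck_set A (a ` s) (a ` M)"
      using * unfolding ellentuck_set_def by (intro CollectI exI[of _ "a ` (x - s)"]) auto
  qed
  moreover have "basic s M \<subseteq> H" by (auto simp: basic_def)
  ultimately show ?thesis unfolding Y_eq by auto
qed

lemma openin_basic:
  assumes "finite s"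
  shows "openin T ((`) a ` basic s M)"
\<comment> \<open>A member of \<open>basic s M\<close> guarantees that \<open>above s M\<close> is
  infinite, as a neighbourhood in the base requires; the empty set is open anyway.\<close>
proof (cases "basic s M = {}")
  case False
  then obtain x where x: "x \<in> H" "x - s \<subseteq> above s M" by (auto simp: basic_def)
  then have "infinite (above s M)"
    using H_infinite assms by (metis finite_Diff2 finite_subset)
  then have inf: "infinite (a ` above s M)"
    using inj_a by (simp add: finite_image_iff inj_on_subset)
  have less: "enum_less a (a ` s) (a ` above s M)"
    by (auto simp: enum_less_def above_def inj_eq[OF inj_a])
  have "ellentuck_set A (a ` s) (a ` above s M) \<in> ellentuck_base A a"
    unfolding ellentuck_base_def using assms inf less range_a by blast
  then have "openin (ellentuck_topology A a) (ellentuck_set A (a ` s) (a ` above s M))"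
    unfolding ellentuck_topology_def by (rule topology_generated_by_Basis)
  then show ?thesis
    using ellentuck_set_eq_basic[OF less assms] basic_above
    unfolding T_def openin_subtopology by metis
qed simp

lemma openin_T_basic:
  assumes "openin T V" "x \<in> H" "a ` x \<in> V"
  shows "\<exists>s M. finite s \<and> x \<in> basic s M \<and> (`) a ` basic s M \<subseteq> V"
proof -
  obtain W where W: "openin (ellentuck_topology A a) W" "V = W \<inter> Y"
    using assms(1) by (auto simp: T_def openin_subtopology)
  then obtain B where B: "B \<in> ellentuck_base A a" "a ` x \<in> B" "B \<subseteq> W"
    using assms(3) openin_ellentuck_topology by (metis IntD1)
  then obtain s' C where sC: "B = ellentuck_set A s' C" "s' \<subseteq> A" "finite s'" "C \<subseteq> A"
      "enum_less a s' C"
    by (auto simp: ellentuck_base_def)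
  define s M where "s = a -` s'" and "M = a -` C"
  have eq: "s' = a ` s" "C = a ` M" using sC range_a by (auto simp: s_def M_def)
  have fin: "finite s" unfolding s_def using sC inj_a by (simp add: finite_vimageI)
  have *: "B \<inter> Y = (`) a ` basic s M"
    using ellentuck_set_eq_basic fin sC eq by simp
  have "a ` x \<in> (`) a ` basic s M" using * B(2) assms(3) W by blast
  then have "x \<in> basic s M" using inj_a by (auto simp: inj_image_eq_iff)
  with fin * B W show ?thesis by blast
qed

text \<open>The complement of the closure is open. A set \<open>basic s M\<close> with
  \<open>M \<in> H\<close> that missed it would give a nonempty open set inside the closure.\<close>

lemma nowhere_dense_imp_dense_open:
  assumes "nowhere_dense_in T F"
  shows "dense_open {x \<in> H. a ` x \<notin> T closure_of F}"
proof -
  have "\<exists>s M. finite s \<and> x \<in> basic s M \<and> basic s M \<subseteq> {x \<in> H. a ` x \<notin> T closure_of F}"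
    if x: "x \<in> H" "a ` x \<notin> T closure_of F" for x
  proof -
    have "openin T (topspace T - T closure_of F)" by (simp add: openin_diff)
    moreover have "a ` x \<in> topspace T - T closure_of F"
      using x by (auto simp: topspace_T Y_eq)
    ultimately obtain s M where sM: "finite s" "x \<in> basic s M"
        "(`) a ` basic s M \<subseteq> topspace T - T closure_of F"
      using openin_T_basic[of "topspace T - T closure_of F" x] x(1) by auto
    moreover have "basic s M \<subseteq> H" by (auto simp: basic_def)
    ultimately have "basic s M \<subseteq> {x \<in> H. a ` x \<notin> T closure_of F}" by blast
    with sM show ?thesis by blast
  qed
  moreover have "basic s M \<inter> {x \<in> H. a ` x \<notin> T closure_of F} \<noteq> {}"
    if "finite s" "M \<in> H" for s M
  proof
    assume "basic s M \<inter> {x \<in> H. a ` x \<notin> T closure_of F} = {}"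
    then have "(`) a ` basic s M \<subseteq> T closure_of F" by (auto simp: basic_def)
    then have "(`) a ` basic s M \<subseteq> T interior_of (T closure_of F)"
      using openin_basic that(1) by (simp add: interior_of_maximal)
    then show False
      using assms union_above_mem_basic[OF that(2,1)] by (auto simp: nowhere_dense_in_def)
  qed
  ultimately show ?thesis unfolding dense_open_def by simp
qed

text \<open>If the closure of \<open>N\<close> contained the image of \<open>basic s M\<close>, the
  complements of the closures of the countably many pieces would share some \<open>basic s D\<close>
  with \<open>D \<subseteq> M\<close>. Its image is nonempty, open and disjoint from
  \<open>N\<close>, yet inside the closure of \<open>N\<close>.\<close>

lemma meager_imp_nowhere_dense:
  assumes "meager_in T N"
  shows "nowhere_dense_in T N"
proof -
  obtain \<F> where \<F>: "countable \<F>" "\<forall>F\<in>\<F>. nowhere_dense_in T F" "N = \<Union>\<F>"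
    using assms unfolding meager_in_def by (elim exE conjE)
  \<comment> \<open>Adding the empty set makes the family nonempty, so that it is the range of a
    sequence.\<close>
  have "nowhere_dense_in T {}" by (simp add: nowhere_dense_in_def)
  then have nd: "nowhere_dense_in T F" if "F \<in> insert {} \<F>" for F
    using that \<F>(2) by blast
  define f where "f = from_nat_into (insert {} \<F>)"
  have "range f = insert {} \<F>"
    unfolding f_def using \<F>(1) by (intro range_from_nat_into) auto
  then have f: "\<And>n. nowhere_dense_in T (f n)" "N = (\<Union>n. f n)"
    using nd rangeI[of f] \<F>(3) by auto
  then have sub: "N \<subseteq> Y"
    unfolding nowhere_dense_in_def topspace_T by blast
  have "E \<notin> T interior_of (T closure_of N)" for E
  proof
    assume E: "E \<in> T interior_of (T closure_of N)"
    moreover have "T interior_of (T closure_of N) \<subseteq> Y"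
      using interior_of_subset_topspace[of T "T closure_of N"] by (simp add: topspace_T)
    ultimately obtain x where x: "x \<in> H" "E = a ` x"
      unfolding Y_eq by blast
    obtain s M where sM: "finite s" "x \<in> basic s M"
        "(`) a ` basic s M \<subseteq> T interior_of (T closure_of N)"
      using openin_T_basic[OF openin_interior_of x(1), of "T closure_of N"] E x(2) by auto
    \<comment> \<open>The interior supplies only a point \<open>x \<in> H\<close> of the basic set;
      \<open>M\<close> contains all of \<open>x\<close> except part of the finite stem.\<close>
    have "M \<in> H"
    proof (rule diff_finite_mem[OF x(1)])
      have "x - M \<subseteq> s" using sM(2) by (auto simp: basic_def above_def)
      then show "finite (x - M)" using sM(1) finite_subset by blast
    qed
    with nowhere_dense_imp_dense_open[OF f(1)] sM(1)
    have "\<exists>D\<in>H. D \<subseteq> M \<and> basic s D \<subseteq> (\<Inter>n. {x \<in> H. a ` x \<notin> T closure_of f n})"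
      by (rule countable_dense_open_contain_basic)
    then obtain D where D: "D \<in> H" "D \<subseteq> M"
        "basic s D \<subseteq> (\<Inter>n. {x \<in> H. a ` x \<notin> T closure_of f n})"
      by (elim bexE conjE)
    define y where "y = s \<union> above s D"
    have y: "y \<in> basic s D" unfolding y_def using D(1) sM(1) by (rule union_above_mem_basic)
    then have "a ` y \<in> T closure_of N"
      using sM(3) basic_mono[OF D(2)] interior_of_subset[of T "T closure_of N"] by blast
    then obtain P where P: "P \<in> N" "P \<in> (`) a ` basic s D"
      using openin_basic[OF sM(1), of D] y by (metis imageI in_closure_of)
    then obtain n z where z: "P \<in> f n" "z \<in> basic s D" "P = a ` z"
      using f(2) by blast
    have "f n \<subseteq> T closure_of f n"
      using f(1)[of n] by (simp add: nowhere_dense_in_def closure_of_subset)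
    then show False using z D(3) by blast
  qed
  then have "T interior_of (T closure_of N) = {}" by blast
  with sub show ?thesis by (simp add: nowhere_dense_in_def topspace_T)
qed

end

lemma nowhere_dense_imp_meager: "nowhere_dense_in T S \<Longrightarrow> meager_in T S"
  unfolding meager_in_def by (intro exI[of _ "{S}"]) auto

theorem theorem6:
  fixes X :: "'a topology"
    and A :: "'a set set"
    and a :: "nat \<Rightarrow> 'a set"
    and N :: "'a set set set"
  assumes "S1 (omega_covers X) (omega_covers X)"
    and "A \<in> omega_covers X"
    and "countable A"
    and "bij_betw a UNIV A"
    and "N \<subseteq> countably_infinite_subsets A \<inter> omega_covers X"
  shows "nowhere_dense_in
           (subtopology (ellentuck_topology A a)
              (countably_infinite_subsets A \<inter> omega_covers X)) N
         \<longleftrightarrow>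
         meager_in
           (subtopology (ellentuck_topology A a)
              (countably_infinite_subsets A \<inter> omega_covers X)) N"
proof -
  interpret enumerated_omega_cover X A a
    using assms by unfold_locales
  show ?thesis
    using meager_imp_nowhere_dense[of N] nowhere_dense_imp_meager[of T N]
    unfolding T_def Y_def by blast
qed

end
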